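(* Let $s,t\in\{1,\dots,d\}$, let $i\le P_s$ and $j\le P_t$ index parameters $\theta^s_i$ and $\theta^t_j$ in the coordinate blocks $\theta^s$ and $\theta^t$, and let $\mathcal G(\theta)_{ij}=\langle \mathcal A\,\partial_{\theta^s_i}u_\theta,\ \mathcal A\,\partial_{\theta^t_j}u_\theta\rangle_{L^2(\mathcal D)}$ be the corresponding entry of the Gauss--Newton Gramian. Then $$\mathcal G(\theta)_{ij}=\sum_{\beta,\gamma=1}^{R_{\mathcal A}}\ \sum_{a,a'}c_a c_{a'}\prod_{m=1}^{d}\Big\langle \mathcal A_m^{(\beta)}\pi_m^{s,i}(a),\ \mathcal A_m^{(\gamma)}\pi_m^{t,j}(a')\Big\rangle_{L^2(\mathcal D_m)},\qquad \pi_m^{s,i}(a):=\begin{cases}\partial_{\theta^s_i}w_s^{a_s},& m=s,\\ w_m^{a_m},& m\ne s,\end{cases}$$ where $a=(a_1,\dots,a_d)$ and $a'=(a_1',\dots,a_d')$ range over all multi-indices with $1\le a_m,a_m'\le k_m$. In particular, $\mathcal G(\theta)_{ij}$ is a sum of at most $\nu^2R_{\mathcal A}^2$ terms, each a product of $d$ univariate inner products, where $\nu$ is the number of nonzero entries of $c$.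
   Context: Domain: $d=d_x+d_\xi$; $\Omega=\mathcal D_1\times\cdots\times\mathcal D_{d_x}$, $\Xi=\mathcal D_{d_x+1}\times\cdots\times\mathcal D_d$, $\mathcal D=\Omega\times\Xi$, where $\mathcal D_m=(z_m^-,z_m^+)\subset\mathbb R$ are bounded open intervals. $L^2(\mathcal D)$ is identified with the Hilbert tensor product $\bigotimes_{m=1}^d L^2(\mathcal D_m)$; the elementary tensor $v_1\otimes\cdots\otimes v_d$ is the function $z\mapsto\prod_m v_m(z_m)$. Operator: $V$ is a Hilbert space of functions on $\Omega$ with bounded trace $V\to L^2(\partial\Omega)$, $U=L^2(\Xi;V)$ (Bochner space), and $\mathcal A:U\to L^2(\mathcal D)$ is bounded and linear. There are Hilbert spaces $H_m\hookrightarrow L^2(\mathcal D_m)$ such that the Hilbert tensor product $H=H_1\otimes\cdots\otimes H_d$ satisfies $\|v_1\otimes\cdots\otimes v_d\|_H=\prod_m\|v_m\|_{H_m}$, $H$ is continuously and densely embedded in $U$, and $\mathcal A|_H=\sum_{\beta=1}^{R_{\mathcal A}}\mathcal A_1^{(\beta)}\otimes\cdots\otimes\mathcal A_d^{(\beta)}$ with $R_{\mathcal A}\in\mathbb N$ and bounded linear $\mathcal A_m^{(\beta)}:H_m\to L^2(\mathcal D_m)$. Architecture: $\theta=(\theta^1,\dots,\theta^d)$, $\theta^m\in\mathbb R^{P_m}$, $P=\sum_mP_m$. For each $m$ there are $k_m\in\mathbb N$ and a differentiable map $\Phi_m^{k_m}:\mathbb R^{P_m}\to H_m^{k_m}$,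 $\theta^m\mapsto(w_m^1,\dots,w_m^{k_m})$ (with $H_m^{k_m}$ the product Hilbert space). For a fixed array $c\in\mathbb R^{k_1\times\cdots\times k_d}$ with entries $c_a=c_{a_1\ldots a_d}$, $$u_\theta=\sum_{a_1=1}^{k_1}\cdots\sum_{a_d=1}^{k_d}c_{a_1\ldots a_d}\,w_1^{a_1}\otimes\cdots\otimes w_d^{a_d}\in H.$$ *)

theory Defs
  imports "HOL-Analysis.Analysis"
begin

text \<open>
  Elements of $L^2$ spaces are represented by functions, and equality of elements is equality
  almost everywhere. The same definitions serve for $L^2(M)$ (with real values) and for the
  Bochner space $L^2(M; V)$. Measurability is strong measurability, so that $V$ need not be
  separable; for real values it is Borel measurability (lemma \<open>L2_real\<close> below).
\<close>

definition strongly_measurable :: "'a measure \<Rightarrow> ('a \<Rightarrow> 'b::metric_space) \<Rightarrow> bool" where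
  "strongly_measurable M f \<longleftrightarrow>
     (\<exists>\<sigma>. (\<forall>n. simple_function M (\<sigma> n)) \<and> (\<forall>x\<in>space M. (\<lambda>n. \<sigma> n x) \<longlonglongrightarrow> f x))"

definition L2 :: "'a measure \<Rightarrow> ('a \<Rightarrow> 'b::real_normed_vector) set" where
  "L2 M = {f. strongly_measurable M f \<and> integrable M (\<lambda>x. (norm (f x))\<^sup>2)}"

definition L2_norm :: "'a measure \<Rightarrow> ('a \<Rightarrow> 'b::real_normed_vector) \<Rightarrow> real" where
  "L2_norm M f = sqrt (LINT x|M. (norm (f x))\<^sup>2)"

definition L2_inner :: "'a measure \<Rightarrow> ('a \<Rightarrow> real) \<Rightarrow> ('a \<Rightarrow> real) \<Rightarrow> real" where
  "L2_inner M f g = (LINT x|M. f x * g x)"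

lemma L2_real:
  fixes f :: "'a \<Rightarrow> real"
  shows "f \<in> L2 M \<longleftrightarrow> f \<in> borel_measurable M \<and> integrable M (\<lambda>x. (f x)\<^sup>2)"
proof -
  have "strongly_measurable M f \<longleftrightarrow> f \<in> borel_measurable M"
  proof
    assume "strongly_measurable M f"
    then show "f \<in> borel_measurable M"
      unfolding strongly_measurable_def
      by (blast intro: borel_measurable_LIMSEQ_metric borel_measurable_simple_function)
  next
    assume "f \<in> borel_measurable M"
    then show "strongly_measurable M f"
      unfolding strongly_measurable_def
      using borel_measurable_implies_sequence_metric[of f M 0] by blast
  qed
  then show ?thesis by (simp add: L2_def)
qed

definition bounded_linear_to_L2 ::
    "'x::real_normed_vector set \<Rightarrow> 'a measure \<Rightarrow> ('x \<Rightarrow> 'a \<Rightarrow> 'b::real_normed_vector) \<Rightarrow> bool" where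
  "bounded_linear_to_L2 S M T \<longleftrightarrow>
     (\<forall>v\<in>S. T v \<in> L2 M) \<and>
     (\<forall>v\<in>S. \<forall>w\<in>S. AE x in M. T (v + w) x = T v x + T w x) \<and>
     (\<forall>r. \<forall>v\<in>S. AE x in M. T (r *\<^sub>R v) x = r *\<^sub>R T v x) \<and>
     (\<exists>C. \<forall>v\<in>S. L2_norm M (T v) \<le> C * norm v)"

definition embedding_to_L2 ::
    "'x::real_normed_vector set \<Rightarrow> 'a measure \<Rightarrow> ('x \<Rightarrow> 'a \<Rightarrow> 'b::real_normed_vector) \<Rightarrow> bool" where
  "embedding_to_L2 S M T \<longleftrightarrow>
     bounded_linear_to_L2 S M T \<and> (\<forall>v\<in>S. (AE x in M. T v x = 0) \<longrightarrow> v = 0)"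

definition dense_in_L2 ::
    "'x set \<Rightarrow> 'a measure \<Rightarrow> ('x \<Rightarrow> 'a \<Rightarrow> 'b::real_normed_vector) \<Rightarrow> bool" where
  "dense_in_L2 S M T \<longleftrightarrow> (\<forall>f\<in>L2 M. \<forall>\<epsilon>>0. \<exists>v\<in>S. L2_norm M (\<lambda>x. f x - T v x) < \<epsilon>)"

text \<open>
  Linearity and the norm bound below imply that the operator respects equality almost everywhere
  in its argument.
\<close>

definition bounded_linear_L2_L2 ::
    "'a measure \<Rightarrow> 'c measure \<Rightarrow>
     (('a \<Rightarrow> 'b::real_normed_vector) \<Rightarrow> 'c \<Rightarrow> 'e::real_normed_vector) \<Rightarrow> bool" where
  "bounded_linear_L2_L2 N M A \<longleftrightarrow>
     (\<forall>f\<in>L2 N. A f \<in> L2 M) \<and>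
     (\<forall>f\<in>L2 N. \<forall>g\<in>L2 N. AE x in M. A (\<lambda>y. f y + g y) x = A f x + A g x) \<and>
     (\<forall>r. \<forall>f\<in>L2 N. AE x in M. A (\<lambda>y. r *\<^sub>R f y) x = r *\<^sub>R A f x) \<and>
     (\<exists>C. \<forall>f\<in>L2 N. L2_norm M (A f) \<le> C * L2_norm N f)"


definition interval_measure1 :: "(nat \<Rightarrow> real) \<Rightarrow> (nat \<Rightarrow> real) \<Rightarrow> nat \<Rightarrow> real measure" where
  "interval_measure1 lo hi m = restrict_space lborel {lo m<..<hi m}"

text \<open>
  Lebesgue measure on the open box $\prod_{m \in I} (lo_m, hi_m)$; its points are functions in
  \<open>\<Pi>\<^sub>E m\<in>I. {lo m<..<hi m}\<close>. With $I$ equal to \<open>{1..dx}\<close>, \<open>{dx+1..d}\<close> and \<open>{1..d}\<close>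
  this gives $\Omega$, $\Xi$ and $\mathcal{D}$.
\<close>

definition box_measure :: "(nat \<Rightarrow> real) \<Rightarrow> (nat \<Rightarrow> real) \<Rightarrow> nat set \<Rightarrow> (nat \<Rightarrow> real) measure" where
  "box_measure lo hi I = PiM I (interval_measure1 lo hi)"

definition box_boundary :: "(nat \<Rightarrow> real) \<Rightarrow> (nat \<Rightarrow> real) \<Rightarrow> nat set \<Rightarrow> (nat \<Rightarrow> real) set" where
  "box_boundary lo hi I = (\<Pi>\<^sub>E m\<in>I. {lo m..hi m}) - (\<Pi>\<^sub>E m\<in>I. {lo m<..<hi m})"

text \<open>
  Surface measure on the boundary of the box: the sum over the faces $\{z_m = b\}$,
  $b \in \{lo_m, hi_m\}$, of the Lebesgue measure in the remaining coordinates. (The edges, where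
  faces meet, are null sets.)
\<close>

definition box_surface_measure ::
    "(nat \<Rightarrow> real) \<Rightarrow> (nat \<Rightarrow> real) \<Rightarrow> nat set \<Rightarrow> (nat \<Rightarrow> real) measure" where
  "box_surface_measure lo hi I =
     measure_of (box_boundary lo hi I)
       (sets (restrict_space (PiM I (\<lambda>_. borel)) (box_boundary lo hi I)))
       (\<lambda>B. \<Sum>m\<in>I. \<Sum>b\<in>{lo m, hi m}.
          emeasure (box_measure lo hi (I - {m}))
            {y \<in> space (box_measure lo hi (I - {m})). y(m := b) \<in> B})"

lemma emeasure_box_surface_measure:
  assumes fin: "finite I" and lohi: "\<And>m. m \<in> I \<Longrightarrow> lo m < hi m"
    and B: "B \<in> sets (restrict_space (PiM I (\<lambda>_. borel)) (box_boundary lo hi I))"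
  shows "emeasure (box_surface_measure lo hi I) B =
    (\<Sum>m\<in>I. \<Sum>b\<in>{lo m, hi m}.
       emeasure (box_measure lo hi (I - {m}))
         {y \<in> space (box_measure lo hi (I - {m})). y(m := b) \<in> B})"
proof -
  define N where "N = restrict_space (PiM I (\<lambda>_. borel::real measure)) (box_boundary lo hi I)"
  define F where "F m b = distr (box_measure lo hi (I - {m})) N (\<lambda>y. y(m := b))" for m b
  have spN: "space N = box_boundary lo hi I"
    by (auto simp: N_def space_restrict_space space_PiM box_boundary_def PiE_def)
  have meas: "(\<lambda>y. y(m := b)) \<in> measurable (box_measure lo hi (I - {m})) N"
    if m: "m \<in> I" and b: "b \<in> {lo m, hi m}" for m b
    unfolding N_def
  proof (rule measurable_restrict_space2)
    have *: "y(m := b) \<in> box_boundary lo hi I"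
      if "y \<in> (\<Pi>\<^sub>E l\<in>I - {m}. {lo l<..<hi l})" for y
    proof -
      have "y(m := b) \<in> (\<Pi>\<^sub>E l\<in>I. {lo l..hi l})"
      proof (rule PiE_I)
        fix l assume "l \<in> I"
        then show "(y(m := b)) l \<in> {lo l..hi l}"
          using PiE_mem[OF that, of l] b lohi[OF m] by (cases "l = m") (auto intro: less_imp_le)
      next
        fix l assume "l \<notin> I"
        then show "(y(m := b)) l = undefined"
          using PiE_arb[OF that, of l] m by auto
      qed
      moreover have "y(m := b) \<notin> (\<Pi>\<^sub>E l\<in>I. {lo l<..<hi l})"
        using b m by (auto simp: PiE_iff dest!: bspec[of _ _ m])
      ultimately show ?thesis by (simp add: box_boundary_def)
    qed
    show "(\<lambda>y. y(m := b)) \<in> space (box_measure lo hi (I - {m})) \<rightarrow> box_boundary lo hi I"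
      using * by (auto simp: box_measure_def space_PiM interval_measure1_def space_restrict_space)
    have ss: "(\<lambda>y. y l) \<in> borel_measurable (box_measure lo hi (I - {m}))" if "l \<in> I - {m}" for l
    proof -
      have "(\<lambda>y. y l) \<in> measurable (box_measure lo hi (I - {m})) (interval_measure1 lo hi l)"
        unfolding box_measure_def using that by (rule measurable_component_singleton)
      moreover have "(\<lambda>r. r) \<in> borel_measurable (interval_measure1 lo hi l)"
        unfolding interval_measure1_def by (intro measurable_restrict_space1) simp
      ultimately show ?thesis by (rule measurable_compose)
    qed
    show "(\<lambda>y. y(m := b)) \<in> measurable (box_measure lo hi (I - {m})) (PiM I (\<lambda>_. borel))"
    proof (rule measurable_PiM_single')
      fix l assume "l \<in> I"
      then show "(\<lambda>y. (y(m := b)) l) \<in> borel_measurable (box_measure lo hi (I - {m}))"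
        using ss[of l] by (cases "l = m") auto
    next
      show "(\<lambda>y. y(m := b)) \<in> space (box_measure lo hi (I - {m})) \<rightarrow> (\<Pi>\<^sub>E l\<in>I. space borel)"
        using m by (auto simp: box_measure_def space_PiM PiE_def extensional_def)
    qed
  qed
  have F: "emeasure (F m b) C = emeasure (box_measure lo hi (I - {m}))
         {y \<in> space (box_measure lo hi (I - {m})). y(m := b) \<in> C}"
    if "m \<in> I" "b \<in> {lo m, hi m}" "C \<in> sets N" for m b C
    unfolding F_def using that
    by (subst emeasure_distr[OF meas]) (auto intro!: arg_cong2[where f = emeasure])
  define \<mu> where "\<mu> C = (\<Sum>m\<in>I. \<Sum>b\<in>{lo m, hi m}.
       emeasure (box_measure lo hi (I - {m}))
         {y \<in> space (box_measure lo hi (I - {m})). y(m := b) \<in> C})" for C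
  have \<mu>: "\<mu> C = (\<Sum>m\<in>I. \<Sum>b\<in>{lo m, hi m}. emeasure (F m b) C)" if "C \<in> sets N" for C
    unfolding \<mu>_def using that by (intro sum.cong refl) (simp add: F)
  have "emeasure (box_surface_measure lo hi I) B = \<mu> B"
  proof (rule emeasure_measure_of[where \<Omega> = "box_boundary lo hi I" and A = "sets N"])
    show "box_surface_measure lo hi I = measure_of (box_boundary lo hi I) (sets N) \<mu>"
      unfolding box_surface_measure_def N_def \<mu>_def ..
    show "sets N \<subseteq> Pow (box_boundary lo hi I)"
      using sets.space_closed[of N] by (simp add: spN)
    have sets: "sets (box_surface_measure lo hi I) = sets N"
      unfolding box_surface_measure_def N_def[symmetric]
      unfolding spN[symmetric] by (rule sets.sets_measure_of_eq)
    show "B \<in> sets (box_surface_measure lo hi I)"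
      using B by (simp add: sets N_def)
    show "positive (sets (box_surface_measure lo hi I)) \<mu>"
      by (simp add: positive_def \<mu>_def)
    show "countably_additive (sets (box_surface_measure lo hi I)) \<mu>"
      unfolding sets
    proof (rule countably_additiveI)
      fix C :: "nat \<Rightarrow> (nat \<Rightarrow> real) set"
      assume C: "range C \<subseteq> sets N" "disjoint_family C" "\<Union> (range C) \<in> sets N"
      have "(\<Sum>n. \<mu> (C n)) = (\<Sum>n. \<Sum>m\<in>I. \<Sum>b\<in>{lo m, hi m}. emeasure (F m b) (C n))"
        using C by (intro suminf_cong \<mu>) auto
      also have "\<dots> = (\<Sum>m\<in>I. \<Sum>b\<in>{lo m, hi m}. \<Sum>n. emeasure (F m b) (C n))"
        by (subst suminf_sum) (auto simp: suminf_sum intro!: summableI)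
      also have "\<dots> = (\<Sum>m\<in>I. \<Sum>b\<in>{lo m, hi m}. emeasure (F m b) (\<Union> (range C)))"
        using C by (intro sum.cong refl suminf_emeasure) (auto simp: F_def)
      finally show "(\<Sum>n. \<mu> (C n)) = \<mu> (\<Union> (range C))"
        using \<mu>[OF C(3)] by simp
    qed
  qed
  then show ?thesis by (simp add: \<mu>_def)
qed

text \<open>
  A Hilbert space $V$ of functions on $\Omega$: \<open>ev v\<close> is the function on $\Omega$ (up to null
  sets) that is the element \<open>v\<close> of $V$.
\<close>

definition function_space_on ::
    "'a measure \<Rightarrow> ('v::real_vector \<Rightarrow> 'a \<Rightarrow> real) \<Rightarrow> bool" where
  "function_space_on M ev \<longleftrightarrow>
     (\<forall>v. ev v \<in> borel_measurable M) \<and>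
     (\<forall>v w. AE x in M. ev (v + w) x = ev v x + ev w x) \<and>
     (\<forall>r v. AE x in M. ev (r *\<^sub>R v) x = r * ev v x) \<and>
     (\<forall>v. (AE x in M. ev v x = 0) \<longrightarrow> v = 0)"

definition bounded_trace ::
    "(nat \<Rightarrow> real) \<Rightarrow> (nat \<Rightarrow> real) \<Rightarrow> nat set \<Rightarrow> ('v::real_normed_vector \<Rightarrow> (nat \<Rightarrow> real) \<Rightarrow> real) \<Rightarrow>
     ('v \<Rightarrow> (nat \<Rightarrow> real) \<Rightarrow> real) \<Rightarrow> bool" where
  "bounded_trace lo hi I ev tr \<longleftrightarrow>
     bounded_linear_to_L2 UNIV (box_surface_measure lo hi I) tr \<and>
     (\<forall>v g. continuous_on (\<Pi>\<^sub>E m\<in>I. {lo m..hi m}) g \<longrightarrow>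
        (AE x in box_measure lo hi I. ev v x = g x) \<longrightarrow>
        (AE x in box_surface_measure lo hi I. tr v x = g x))"


text \<open>
  A family of Hilbert spaces $H_m$, one for each \<open>m \<in> I\<close>, is given by closed subspaces of a
  common Hilbert space. This is no restriction for finite \<open>I\<close>: take the Hilbert direct sum.
\<close>

definition hilbert_family :: "nat set \<Rightarrow> (nat \<Rightarrow> 'h::{real_inner,complete_space} set) \<Rightarrow> bool" where
  "hilbert_family I H \<longleftrightarrow> (\<forall>m\<in>I. subspace (H m) \<and> closed (H m))"

text \<open>
  The type \<open>'t\<close>, with elementary tensors \<open>tens v\<close> for \<open>v \<in> Pi I H\<close>, is the Hilbert tensor
  product of the $H_m$. The formula for inner products implies multilinearity, and that
  \<open>tens v\<close> depends only on the \<open>v m\<close> with \<open>m \<in> I\<close>.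
\<close>

definition hilbert_tensor_product ::
    "nat set \<Rightarrow> (nat \<Rightarrow> 'h::{real_inner,complete_space} set) \<Rightarrow>
     ((nat \<Rightarrow> 'h) \<Rightarrow> 't::{real_inner,complete_space}) \<Rightarrow> bool" where
  "hilbert_tensor_product I H tens \<longleftrightarrow>
     (\<forall>v\<in>Pi I H. \<forall>w\<in>Pi I H. inner (tens v) (tens w) = (\<Prod>m\<in>I. inner (v m) (w m))) \<and>
     closure (span (tens ` Pi I H)) = UNIV"

definition tensor_function :: "nat set \<Rightarrow> (nat \<Rightarrow> real \<Rightarrow> real) \<Rightarrow> (nat \<Rightarrow> real) \<Rightarrow> real" where
  "tensor_function I f z = (\<Prod>m\<in>I. f m (z m))"

text \<open>
  \<open>T\<close> is the tensor product operator $B_1 \otimes \cdots \otimes B_d : H \to L^2(\mathcal{D})$,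
  the bounded linear operator with
  $v_1 \otimes \cdots \otimes v_d \mapsto B_1 v_1 \otimes \cdots \otimes B_d v_d$.
\<close>

definition tensor_operator ::
    "(nat \<Rightarrow> real) \<Rightarrow> (nat \<Rightarrow> real) \<Rightarrow> nat set \<Rightarrow> (nat \<Rightarrow> 'h::{real_inner,complete_space} set) \<Rightarrow>
     ((nat \<Rightarrow> 'h) \<Rightarrow> 't::{real_inner,complete_space}) \<Rightarrow>
     (nat \<Rightarrow> 'h \<Rightarrow> real \<Rightarrow> real) \<Rightarrow> ('t \<Rightarrow> (nat \<Rightarrow> real) \<Rightarrow> real) \<Rightarrow> bool" where
  "tensor_operator lo hi I H tens B T \<longleftrightarrow>
     bounded_linear_to_L2 UNIV (box_measure lo hi I) T \<and>
     (\<forall>v\<in>Pi I H. AE z in box_measure lo hi I.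
        T (tens v) z = tensor_function I (\<lambda>m. B m (v m)) z)"


text \<open>
  A vector in $\mathbb{R}^P$ is a function on \<open>nat\<close> of which only the values at \<open>{1..P}\<close> matter;
  likewise for $H_m^k$. The definition is Frechet differentiability at \<open>x\<close> for the Euclidean norm
  on $\mathbb{R}^P$ and the product Hilbert norm on the target, with derivative
  $h \mapsto (\sum_i h_i\, G_{i,a})_a$. Increments \<open>h\<close> that vanish on \<open>{1..P}\<close> show that the map
  does not depend on the other coordinates.
\<close>

definition differentiable_map_at ::
    "nat \<Rightarrow> nat \<Rightarrow> ((nat \<Rightarrow> real) \<Rightarrow> nat \<Rightarrow> 'h::real_inner) \<Rightarrow> (nat \<Rightarrow> real) \<Rightarrow> bool" where
  "differentiable_map_at P k \<Phi> x \<longleftrightarrow>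
     (\<exists>G. \<forall>\<epsilon>>0. \<exists>\<delta>>0. \<forall>h. L2_set h {1..P} < \<delta> \<longrightarrow>
        L2_set (\<lambda>a. norm (\<Phi> (\<lambda>i. x i + h i) a - \<Phi> x a - (\<Sum>i=1..P. h i *\<^sub>R G i a))) {1..k}
          \<le> \<epsilon> * L2_set h {1..P})"

definition partial_derivative ::
    "nat \<Rightarrow> ((nat \<Rightarrow> real) \<Rightarrow> 'x::real_normed_vector) \<Rightarrow> (nat \<Rightarrow> real) \<Rightarrow> 'x" where
  "partial_derivative i f x = vector_derivative (\<lambda>r. f (x(i := r))) (at (x i))"

definition multi_indices :: "nat \<Rightarrow> (nat \<Rightarrow> nat) \<Rightarrow> (nat \<Rightarrow> nat) set" where
  "multi_indices d k = (\<Pi>\<^sub>E m\<in>{1..d}. {1..k m})"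

definition tensor_network ::
    "nat \<Rightarrow> (nat \<Rightarrow> nat) \<Rightarrow> ((nat \<Rightarrow> nat) \<Rightarrow> real) \<Rightarrow> ((nat \<Rightarrow> 'h) \<Rightarrow> 't::real_vector) \<Rightarrow>
     (nat \<Rightarrow> (nat \<Rightarrow> real) \<Rightarrow> nat \<Rightarrow> 'h) \<Rightarrow> (nat \<Rightarrow> nat \<Rightarrow> real) \<Rightarrow> 't" where
  "tensor_network d k c tens \<Phi> \<theta> =
     (\<Sum>a\<in>multi_indices d k. c a *\<^sub>R tens (\<lambda>m. \<Phi> m (\<theta> m) (a m)))"

definition factor_derivative ::
    "(nat \<Rightarrow> (nat \<Rightarrow> real) \<Rightarrow> nat \<Rightarrow> 'h::real_normed_vector) \<Rightarrow> (nat \<Rightarrow> nat \<Rightarrow> real) \<Rightarrow>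
     nat \<Rightarrow> nat \<Rightarrow> (nat \<Rightarrow> nat) \<Rightarrow> nat \<Rightarrow> 'h" where
  "factor_derivative \<Phi> \<theta> s i a m =
     (if m = s then partial_derivative i (\<lambda>x. \<Phi> s x (a s)) (\<theta> s) else \<Phi> m (\<theta> m) (a m))"

text \<open>
  \<open>\<partial>u/\<partial>\<theta>\<^sup>s\<^sub>i\<close>, for a map \<open>u\<close> of all parameter blocks \<open>\<theta> 1, \<theta> 2, \<dots>\<close>
\<close>

definition block_derivative ::
    "nat \<Rightarrow> nat \<Rightarrow> ((nat \<Rightarrow> nat \<Rightarrow> real) \<Rightarrow> 'x::real_normed_vector) \<Rightarrow> (nat \<Rightarrow> nat \<Rightarrow> real) \<Rightarrow> 'x" where
  "block_derivative s i u \<theta> = partial_derivative i (\<lambda>x. u (\<theta>(s := x))) (\<theta> s)"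

text \<open>
  \<open>emb\<close> is the embedding of $H$ in $U$, through which the operator \<open>A\<close> on $U$ acts on the
  tangent vectors $\partial u_\theta \in H$.
\<close>

definition gramian_entry ::
    "'c measure \<Rightarrow> ('u \<Rightarrow> 'c \<Rightarrow> real) \<Rightarrow> ('t::real_normed_vector \<Rightarrow> 'u) \<Rightarrow>
     ((nat \<Rightarrow> nat \<Rightarrow> real) \<Rightarrow> 't) \<Rightarrow> (nat \<Rightarrow> nat \<Rightarrow> real) \<Rightarrow> nat \<Rightarrow> nat \<Rightarrow> nat \<Rightarrow> nat \<Rightarrow> real" where
  "gramian_entry M A emb u \<theta> s i t j =
     L2_inner M (A (emb (block_derivative s i u \<theta>))) (A (emb (block_derivative t j u \<theta>)))"

end

theory Submission
  imports Defs
begin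

text \<open>
  In one slot, with the other factors fixed, the elementary tensor is a scalar multiple of a linear
  isometry on $H_s$, so differentiating the network in a parameter of block $s$ just replaces
  the $s$-th factor of each elementary tensor by its derivative, which stays in the closed
  subspace $H_s$. The tensor product operators map the resulting elementary tensors to products of
  univariate functions, and Fubini's theorem factors their $L^2$ inner products.
\<close>

section \<open>Inner products of product functions\<close>

lemma L2_mult_integrable:
  fixes f g :: "'a \<Rightarrow> real"
  assumes "f \<in> L2 M" "g \<in> L2 M"
  shows "integrable M (\<lambda>x. f x * g x)"
proof (rule Bochner_Integration.integrable_bound)
  show "integrable M (\<lambda>x. (f x)\<^sup>2 + (g x)\<^sup>2)"
    using assms by (simp add: L2_real)
  show "(\<lambda>x. f x * g x) \<in> borel_measurable M"
    using assms by (auto simp: L2_real)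
  \<comment> \<open>The square of \<open>\<bar>p\<bar> - \<bar>q\<bar>\<close> is nonnegative, which
    bounds even \<open>2 * \<bar>p * q\<bar>\<close>; the factor 2 is then dropped.\<close>
  have "\<bar>p * q\<bar> \<le> p\<^sup>2 + q\<^sup>2" for p q :: real
    using sum_squares_bound[of "\<bar>p\<bar>" "\<bar>q\<bar>"] abs_ge_zero[of "p * q"]
    unfolding abs_mult power2_abs by linarith
  then show "AE x in M. norm (f x * g x) \<le> norm ((f x)\<^sup>2 + (g x)\<^sup>2)"
    by simp
qed

text \<open>The product of two product functions is again a product function, with the integrable
  factors \<open>f m * g m\<close>. Fubini for finitely many sigma-finite measures then gives both
  integrability and the value of the integral.\<close>

lemma
  assumes "\<And>m. m \<in> I \<Longrightarrow> f m \<in> L2 (interval_measure1 lo hi m)"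
    and "\<And>m. m \<in> I \<Longrightarrow> g m \<in> L2 (interval_measure1 lo hi m)"
    and "finite I"
  shows integrable_tensor_function_mult:
      "integrable (box_measure lo hi I) (\<lambda>z. tensor_function I f z * tensor_function I g z)"
    and L2_inner_tensor_function:
      "L2_inner (box_measure lo hi I) (tensor_function I f) (tensor_function I g) =
        (\<Prod>m\<in>I. L2_inner (interval_measure1 lo hi m) (f m) (g m))"
proof -
  interpret product_sigma_finite "interval_measure1 lo hi"
    unfolding product_sigma_finite_def interval_measure1_def
    by (auto intro!: sigma_finite_measure_restrict_space lborel.sigma_finite_measure_axioms)
  have int: "integrable (interval_measure1 lo hi m) (\<lambda>x. f m x * g m x)" if "m \<in> I" for m
    using assms that by (intro L2_mult_integrable) auto
  show "integrable (box_measure lo hi I) (\<lambda>z. tensor_function I f z * tensor_function I g z)"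
    using product_integrable_prod[OF \<open>finite I\<close> int]
    by (simp add: box_measure_def tensor_function_def prod.distrib)
  show "L2_inner (box_measure lo hi I) (tensor_function I f) (tensor_function I g) =
      (\<Prod>m\<in>I. L2_inner (interval_measure1 lo hi m) (f m) (g m))"
    using product_integral_prod[OF \<open>finite I\<close> int]
    by (simp add: box_measure_def tensor_function_def L2_inner_def prod.distrib)
qed

section \<open>Operators that are linear almost everywhere\<close>

text \<open>Additivity and homogeneity hold off null sets that depend on the vectors. Induction over
  the finite set \<open>J\<close> discards only finitely many of these sets.\<close>

lemma bounded_linear_to_L2_sum:
  assumes "bounded_linear_to_L2 UNIV M T" "finite J"
  shows "AE z in M. T (\<Sum>a\<in>J. c a *\<^sub>R h a) z = (\<Sum>a\<in>J. c a *\<^sub>R T (h a) z)"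
  using \<open>finite J\<close>
proof (induction J)
  case empty
  \<comment> \<open>Homogeneity with the scalar 0 shows that \<open>T 0\<close> vanishes almost
    everywhere.\<close>
  have "AE z in M. T (0 *\<^sub>R 0) z = 0 *\<^sub>R T 0 z"
    using assms(1) unfolding bounded_linear_to_L2_def by blast
  then show ?case by simp
next
  case (insert b J)
  have "AE z in M. T (c b *\<^sub>R h b + (\<Sum>a\<in>J. c a *\<^sub>R h a)) z =
      T (c b *\<^sub>R h b) z + T (\<Sum>a\<in>J. c a *\<^sub>R h a) z"
    and "AE z in M. T (c b *\<^sub>R h b) z = c b *\<^sub>R T (h b) z"
    using assms(1) unfolding bounded_linear_to_L2_def by blast+
  with insert.IH show ?case
    by eventually_elim (simp add: insert.hyps)
qed

section \<open>Elementary tensors as functions of one factor\<close>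

text \<open>The factors away from \<open>s\<close> are the same on both sides, so they contribute a
  constant, the product of their squared norms.\<close>

lemma inner_tens_upd:
  assumes "hilbert_tensor_product I H tens" "finite I" "s \<in> I" "v \<in> Pi I H" "x \<in> H s" "y \<in> H s"
  shows "inner (tens (v(s := x))) (tens (v(s := y))) =
    (\<Prod>m\<in>I - {s}. inner (v m) (v m)) * inner x y"
proof -
  have "v(s := x) \<in> Pi I H" "v(s := y) \<in> Pi I H"
    using assms by auto
  then have "inner (tens (v(s := x))) (tens (v(s := y))) =
      (\<Prod>m\<in>I. inner ((v(s := x)) m) ((v(s := y)) m))"
    using assms(1) unfolding hilbert_tensor_product_def by blast
  also have "\<dots> = (\<Prod>m\<in>I - {s}. inner ((v(s := x)) m) ((v(s := y)) m)) * inner x y"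
    using assms by (simp add: prod.remove[of I s] mult.commute)
  also have "(\<Prod>m\<in>I - {s}. inner ((v(s := x)) m) ((v(s := y)) m)) =
      (\<Prod>m\<in>I - {s}. inner (v m) (v m))"
    by (intro prod.cong) auto
  finally show ?thesis .
qed

text \<open>Linearity in one slot follows from the inner product formula: the defect
  \<open>D\<close> is orthogonal to every tensor that differs from \<open>tens v\<close> in slot
  \<open>s\<close> only, and \<open>D\<close> is itself a combination of such tensors.\<close>

lemma tens_upd_diff:
  assumes tp: "hilbert_tensor_product I H tens" "finite I" "s \<in> I" "v \<in> Pi I H"
    and H: "subspace (H s)" "x \<in> H s" "y \<in> H s" "w \<in> H s"
  shows "tens (v(s := x - y - r *\<^sub>R w)) =
    tens (v(s := x)) - tens (v(s := y)) - r *\<^sub>R tens (v(s := w))"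
proof -
  have z: "x - y - r *\<^sub>R w \<in> H s"
    using H by (intro subspace_diff subspace_scale)
  define D where "D = tens (v(s := x - y - r *\<^sub>R w)) -
    (tens (v(s := x)) - tens (v(s := y)) - r *\<^sub>R tens (v(s := w)))"
  have orth: "inner D (tens (v(s := e))) = 0" if "e \<in> H s" for e
    using inner_tens_upd[OF tp z that] inner_tens_upd[OF tp H(2) that]
      inner_tens_upd[OF tp H(3) that] inner_tens_upd[OF tp H(4) that]
    unfolding D_def by (simp add: inner_diff_left algebra_simps)
  \<comment> \<open>Expanding only the second \<open>D\<close> leaves inner products of
    \<open>D\<close> with four tensors, each zero by \<open>orth\<close>.\<close>
  have "inner D D = 0"
    using orth[OF z] orth[OF H(2)] orth[OF H(3)] orth[OF H(4)]
    by (subst (2) D_def) (simp add: inner_diff_right)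
  then show ?thesis by (simp add: D_def)
qed

lemma norm_tens_upd:
  assumes "hilbert_tensor_product I H tens" "finite I" "s \<in> I" "v \<in> Pi I H" "x \<in> H s"
  shows "norm (tens (v(s := x))) = sqrt (\<Prod>m\<in>I - {s}. inner (v m) (v m)) * norm x"
  by (simp add: norm_eq_sqrt_inner inner_tens_upd[OF assms assms(5)] real_sqrt_mult)

text \<open>On \<open>H s\<close> the map \<open>x \<mapsto> tens (v(s := x))\<close> is linear and
  multiplies norms by \<open>K\<close>. So the norm of the first-order remainder of the tensor curve
  is \<open>K\<close> times that of \<open>f\<close>.\<close>

lemma tens_upd_has_vector_derivative:
  assumes tp: "hilbert_tensor_product I H tens" "finite I" "s \<in> I" "v \<in> Pi I H"
    and H: "subspace (H s)" "\<And>r. f r \<in> H s" "f' \<in> H s"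
    and f: "(f has_vector_derivative f') (at x)"
  shows "((\<lambda>r. tens (v(s := f r))) has_vector_derivative tens (v(s := f'))) (at x)"
proof -
  define K where "K = sqrt (\<Prod>m\<in>I - {s}. inner (v m) (v m))"
  have "norm (tens (v(s := f y)) - tens (v(s := f x)) - (y - x) *\<^sub>R tens (v(s := f')))
      = K * norm (f y - f x - (y - x) *\<^sub>R f')" for y
  proof -
    \<comment> \<open>The inner product formula is given for factors in the \<open>H m\<close>, so
      the remainder has to lie in \<open>H s\<close>.\<close>
    have "f y - f x - (y - x) *\<^sub>R f' \<in> H s"
      using H by (intro subspace_diff subspace_scale)
    from norm_tens_upd[OF tp this] show ?thesis
      by (simp add: tens_upd_diff[OF tp] H K_def)
  qed
  moreover have "((\<lambda>y. K * (norm (f y - f x - (y - x) *\<^sub>R f') / norm (y - x))) \<longlongrightarrow> 0) (at x)"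
    using f unfolding has_vector_derivative_def has_derivative_iff_norm
    by (intro tendsto_mult_right_zero) simp
  ultimately show ?thesis
    unfolding has_vector_derivative_def has_derivative_iff_norm
    by (simp add: bounded_linear_scaleR_left)
qed

section \<open>Derivatives in closed subspaces and in coordinate directions\<close>

text \<open>The derivative is the limit of difference quotients, which all lie in \<open>S\<close>.
  This keeps the differentiated factor in \<open>H s\<close>.\<close>

lemma has_vector_derivative_in_closed_subspace:
  assumes "subspace S" "closed S" "\<And>r. f r \<in> S" and f: "(f has_vector_derivative f') (at x)"
  shows "f' \<in> S"
proof (rule Lim_in_closed_set[OF \<open>closed S\<close>])
  have "((\<lambda>y. norm ((f y - f x) /\<^sub>R (y - x) - f')) \<longlongrightarrow> 0) (at x)"
  proof (rule Lim_transform_eventually)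
    show "((\<lambda>y. norm (f y - f x - (y - x) *\<^sub>R f') / norm (y - x)) \<longlongrightarrow> 0) (at x)"
      using f unfolding has_vector_derivative_def has_derivative_iff_norm by simp
    have "norm (f y - f x - (y - x) *\<^sub>R f') / norm (y - x) = norm ((f y - f x) /\<^sub>R (y - x) - f')"
      if "y \<noteq> x" for y
    proof -
      have "(f y - f x) /\<^sub>R (y - x) - f' = (f y - f x - (y - x) *\<^sub>R f') /\<^sub>R (y - x)"
        using that by (simp add: scaleR_diff_right)
      then show ?thesis by (simp add: divide_inverse_commute)
    qed
    then show "\<forall>\<^sub>F y in at x. norm (f y - f x - (y - x) *\<^sub>R f') / norm (y - x) =
        norm ((f y - f x) /\<^sub>R (y - x) - f')"
      by (auto simp: eventually_at_filter)
  qed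
  then show "((\<lambda>y. (f y - f x) /\<^sub>R (y - x)) \<longlongrightarrow> f') (at x)"
    by (simp add: tendsto_norm_zero_iff LIM_zero_iff)
  show "eventually (\<lambda>y. (f y - f x) /\<^sub>R (y - x) \<in> S) (at x)"
    using assms by (intro always_eventually allI subspace_scale subspace_diff)
qed simp

text \<open>Restricting the Frechet estimate to increments along coordinate \<open>i\<close> and to
  component \<open>a\<close> yields the derivative \<open>G i a\<close>; uniqueness of derivatives
  identifies it with \<open>partial_derivative\<close>.\<close>

lemma differentiable_map_at_partial:
  assumes "differentiable_map_at P k \<Phi> x" "i \<in> {1..P}" "a \<in> {1..k}"
  shows "((\<lambda>r. \<Phi> (x(i := r)) a) has_vector_derivative partial_derivative i (\<lambda>x. \<Phi> x a) x) (at (x i))"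
proof -
  obtain G where G: "\<forall>\<epsilon>>0. \<exists>\<delta>>0. \<forall>h. L2_set h {1..P} < \<delta> \<longrightarrow>
      L2_set (\<lambda>a. norm (\<Phi> (\<lambda>i. x i + h i) a - \<Phi> x a - (\<Sum>i=1..P. h i *\<^sub>R G i a))) {1..k}
        \<le> \<epsilon> * L2_set h {1..P}"
    using assms(1) unfolding differentiable_map_at_def by (rule exE)
  have "((\<lambda>r. \<Phi> (x(i := r)) a) has_vector_derivative G i a) (at (x i))"
    unfolding has_vector_derivative_def has_derivative_within_alt2
  proof (intro conjI allI impI bounded_linear_scaleR_left)
    fix \<epsilon> :: real assume "\<epsilon> > 0"
    then obtain \<delta> where \<delta>: "\<delta> > 0" and le: "\<And>h. L2_set h {1..P} < \<delta> \<Longrightarrow>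
        L2_set (\<lambda>a. norm (\<Phi> (\<lambda>i. x i + h i) a - \<Phi> x a - (\<Sum>i=1..P. h i *\<^sub>R G i a))) {1..k}
          \<le> \<epsilon> * L2_set h {1..P}"
      using G by blast
    have "norm (\<Phi> (x(i := r)) a - \<Phi> (x(i := x i)) a - (r - x i) *\<^sub>R G i a) \<le> \<epsilon> * norm (r - x i)"
      if "dist r (x i) < \<delta>" for r
    proof -
      \<comment> \<open>The increment in direction \<open>i\<close>: its Euclidean norm is
        \<open>\<bar>r - x i\<bar>\<close>, and in the sum over \<open>G\<close> only the term at
        \<open>i\<close> survives.\<close>
      define h where "h l = (if l = i then r - x i else 0)" for l
      have h: "L2_set h {1..P} = \<bar>r - x i\<bar>"
      proof -
        have "(\<Sum>l=1..P. (h l)\<^sup>2) = (\<Sum>l=1..P. if l = i then (r - x i)\<^sup>2 else 0)"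
          by (intro sum.cong) (auto simp: h_def)
        also have "\<dots> = (r - x i)\<^sup>2"
          using assms(2) by simp
        finally show ?thesis by (simp add: L2_set_def)
      qed
      have "(\<Sum>l=1..P. h l *\<^sub>R G l b) = (r - x i) *\<^sub>R G i b" for b
      proof -
        have "(\<Sum>l=1..P. h l *\<^sub>R G l b) = (\<Sum>l=1..P. if l = i then (r - x i) *\<^sub>R G i b else 0)"
          by (intro sum.cong) (auto simp: h_def)
        also have "\<dots> = (r - x i) *\<^sub>R G i b"
          using assms(2) by simp
        finally show ?thesis .
      qed
      moreover have "(\<lambda>l. x l + h l) = x(i := r)"
        by (auto simp: h_def)
      moreover have "L2_set h {1..P} < \<delta>"
        unfolding h using that by (simp add: dist_real_def)
      ultimately have
        "L2_set (\<lambda>b. norm (\<Phi> (x(i := r)) b - \<Phi> x b - (r - x i) *\<^sub>R G i b)) {1..k} \<le> \<epsilon> * \<bar>r - x i\<bar>"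
        using le[of h] unfolding h by simp
      \<comment> \<open>One component is bounded by the product norm over all components, since
        \<open>a\<close> is one of the indices in \<open>{1..k}\<close>.\<close>
      moreover have "norm (\<Phi> (x(i := r)) a - \<Phi> x a - (r - x i) *\<^sub>R G i a) \<le>
          L2_set (\<lambda>b. norm (\<Phi> (x(i := r)) b - \<Phi> x b - (r - x i) *\<^sub>R G i b)) {1..k}"
        using assms(3) by (intro member_le_L2_set) auto
      ultimately show ?thesis by simp
    qed
    with \<delta> show "\<forall>\<^sub>F r in at (x i).
        norm (\<Phi> (x(i := r)) a - \<Phi> (x(i := x i)) a - (r - x i) *\<^sub>R G i a) \<le> \<epsilon> * norm (r - x i)"
      by (auto simp: eventually_at)
  qed
  then show ?thesis
    by (simp add: partial_derivative_def vector_derivative_at)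
qed

section \<open>Differentiating the tensor network\<close>

lemma finite_multi_indices: "finite (multi_indices d k)"
  by (simp add: multi_indices_def finite_PiE)

text \<open>Varying a parameter of block \<open>s\<close> moves only the factor at \<open>s\<close>
  of each elementary tensor, so the finite sum is differentiated term by term with the one-slot
  rule. That the new factors lie in the \<open>H m\<close> lets the tensor operators act on the
  result.\<close>

lemma
  fixes H :: "nat \<Rightarrow> 'h::{real_inner,complete_space} set"
    and tens :: "(nat \<Rightarrow> 'h) \<Rightarrow> 't::{real_inner,complete_space}"
  assumes H: "hilbert_family {1..d} H" and tens: "hilbert_tensor_product {1..d} H tens"
    and range: "\<And>m x a. m \<in> {1..d} \<Longrightarrow> a \<in> {1..k m} \<Longrightarrow> \<Phi> m x a \<in> H m"
    and diff: "differentiable_map_at (P s) (k s) (\<Phi> s) (\<theta> s)"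
    and s: "s \<in> {1..d}" and i: "i \<in> {1..P s}"
  shows factor_derivative_in:
      "a \<in> multi_indices d k \<Longrightarrow> factor_derivative \<Phi> \<theta> s i a \<in> Pi {1..d} H"
    and block_derivative_tensor_network:
      "block_derivative s i (tensor_network d k c tens \<Phi>) \<theta> =
        (\<Sum>a\<in>multi_indices d k. c a *\<^sub>R tens (factor_derivative \<Phi> \<theta> s i a))"
proof -
  define w where "w a m = \<Phi> m (\<theta> m) (a m)" for a m
  define w' where "w' a = partial_derivative i (\<lambda>x. \<Phi> s x (a s)) (\<theta> s)" for a :: "nat \<Rightarrow> nat"
  \<comment> \<open>The differentiated tuple is written as a one-slot update of \<open>w a\<close>,
    the form in which the one-slot rule applies.\<close>
  have fd: "factor_derivative \<Phi> \<theta> s i a = (w a)(s := w' a)" for a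
    by (auto simp: factor_derivative_def w_def w'_def)
  have Hs: "subspace (H s)" "closed (H s)"
    using H s by (auto simp: hilbert_family_def)
  have as: "a m \<in> {1..k m}" if "a \<in> multi_indices d k" "m \<in> {1..d}" for a m
    using that unfolding multi_indices_def by (rule PiE_mem)
  have w: "w a \<in> Pi {1..d} H" if "a \<in> multi_indices d k" for a
    unfolding w_def using range as[OF that] by blast
  have \<Phi>H: "\<Phi> s x (a s) \<in> H s" if "a \<in> multi_indices d k" for a x
    using range as[OF that s] s by blast
  have deriv: "((\<lambda>r. \<Phi> s ((\<theta> s)(i := r)) (a s)) has_vector_derivative w' a) (at (\<theta> s i))"
    if "a \<in> multi_indices d k" for a
    unfolding w'_def using differentiable_map_at_partial[OF diff i as[OF that s]] .
  have w': "w' a \<in> H s" if "a \<in> multi_indices d k" for a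
    using has_vector_derivative_in_closed_subspace[OF Hs \<Phi>H[OF that] deriv[OF that]] .
  show "factor_derivative \<Phi> \<theta> s i a \<in> Pi {1..d} H" if "a \<in> multi_indices d k"
    unfolding fd using w[OF that] w'[OF that] by auto
  \<comment> \<open>The same form for the network itself: with the other blocks frozen, only slot
    \<open>s\<close> depends on \<open>x\<close>.\<close>
  have upd: "(\<lambda>m. \<Phi> m ((\<theta>(s := x)) m) (a m)) = (w a)(s := \<Phi> s x (a s))" for a x
    by (auto simp: w_def)
  have "((\<lambda>r. \<Sum>a\<in>multi_indices d k. c a *\<^sub>R tens ((w a)(s := \<Phi> s ((\<theta> s)(i := r)) (a s))))
      has_vector_derivative (\<Sum>a\<in>multi_indices d k. c a *\<^sub>R tens ((w a)(s := w' a)))) (at (\<theta> s i))"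
  proof (intro has_vector_derivative_sum)
    fix a assume a: "a \<in> multi_indices d k"
    show "((\<lambda>r. c a *\<^sub>R tens ((w a)(s := \<Phi> s ((\<theta> s)(i := r)) (a s))))
        has_vector_derivative c a *\<^sub>R tens ((w a)(s := w' a))) (at (\<theta> s i))"
      using tens_upd_has_vector_derivative[OF tens _ s w[OF a] Hs(1) \<Phi>H[OF a] w'[OF a] deriv[OF a]]
      by (intro bounded_linear.has_vector_derivative[OF bounded_linear_scaleR_right]) simp
  qed
  then show "block_derivative s i (tensor_network d k c tens \<Phi>) \<theta> =
      (\<Sum>a\<in>multi_indices d k. c a *\<^sub>R tens (factor_derivative \<Phi> \<theta> s i a))"
    unfolding block_derivative_def partial_derivative_def tensor_network_def upd fd
    by (rule vector_derivative_at)
qed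

section \<open>Expansion of inner products under the tensor operators\<close>

text \<open>Bilinearity over finite sums, with Fubini for each term. The functions \<open>F\<close>
  and \<open>G\<close> are known only up to null sets, so their measurability is what allows the
  expansion under the integral.\<close>

lemma L2_inner_sum_tensor_function:
  fixes c :: "'a \<Rightarrow> real" and J :: "'b set"
  assumes fin: "finite I" "finite J" "finite K"
    and f: "\<And>\<beta> a m. \<beta> \<in> J \<Longrightarrow> a \<in> K \<Longrightarrow> m \<in> I \<Longrightarrow> f \<beta> a m \<in> L2 (interval_measure1 lo hi m)"
    and g: "\<And>\<beta> a m. \<beta> \<in> J \<Longrightarrow> a \<in> K \<Longrightarrow> m \<in> I \<Longrightarrow> g \<beta> a m \<in> L2 (interval_measure1 lo hi m)"
    and meas: "F \<in> borel_measurable (box_measure lo hi I)" "G \<in> borel_measurable (box_measure lo hi I)"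
    and F: "AE z in box_measure lo hi I. F z = (\<Sum>\<beta>\<in>J. \<Sum>a\<in>K. c a * tensor_function I (f \<beta> a) z)"
    and G: "AE z in box_measure lo hi I. G z = (\<Sum>\<beta>\<in>J. \<Sum>a\<in>K. c a * tensor_function I (g \<beta> a) z)"
  shows "L2_inner (box_measure lo hi I) F G =
    (\<Sum>\<beta>\<in>J. \<Sum>\<gamma>\<in>J. \<Sum>a\<in>K. \<Sum>b\<in>K. c a * c b *
      (\<Prod>m\<in>I. L2_inner (interval_measure1 lo hi m) (f \<beta> a m) (g \<gamma> b m)))"
proof -
  let ?M = "box_measure lo hi I"
  let ?h = "\<lambda>\<beta> \<gamma> a b z. c a * c b * (tensor_function I (f \<beta> a) z * tensor_function I (g \<gamma> b) z)"
  have int: "integrable ?M (?h \<beta> \<gamma> a b)" if "\<beta> \<in> J" "\<gamma> \<in> J" "a \<in> K" "b \<in> K" for \<beta> \<gamma> a b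
    using that f g fin by (intro integrable_mult_right integrable_tensor_function_mult) auto
  have "L2_inner ?M F G = (LINT z|?M. (\<Sum>\<beta>\<in>J. \<Sum>\<gamma>\<in>J. \<Sum>a\<in>K. \<Sum>b\<in>K. ?h \<beta> \<gamma> a b z))"
    unfolding L2_inner_def
  proof (rule integral_cong_AE)
    show "(\<lambda>z. F z * G z) \<in> borel_measurable ?M"
      using meas by (rule borel_measurable_times)
    show "(\<lambda>z. \<Sum>\<beta>\<in>J. \<Sum>\<gamma>\<in>J. \<Sum>a\<in>K. \<Sum>b\<in>K. ?h \<beta> \<gamma> a b z) \<in> borel_measurable ?M"
      by (intro borel_measurable_sum borel_measurable_integrable int)
    from F G show "AE z in ?M. F z * G z = (\<Sum>\<beta>\<in>J. \<Sum>\<gamma>\<in>J. \<Sum>a\<in>K. \<Sum>b\<in>K. ?h \<beta> \<gamma> a b z)"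
      by eventually_elim (simp add: sum_product mult_ac)
  qed
  also have "\<dots> = (\<Sum>\<beta>\<in>J. \<Sum>\<gamma>\<in>J. \<Sum>a\<in>K. \<Sum>b\<in>K. LINT z|?M. ?h \<beta> \<gamma> a b z)"
    using int by (simp add: Bochner_Integration.integral_sum)
  also have "\<dots> = (\<Sum>\<beta>\<in>J. \<Sum>\<gamma>\<in>J. \<Sum>a\<in>K. \<Sum>b\<in>K. c a * c b *
      (\<Prod>m\<in>I. L2_inner (interval_measure1 lo hi m) (f \<beta> a m) (g \<gamma> b m)))"
    using L2_inner_tensor_function[of I "f _ _" lo hi "g _ _", OF f g fin(1)]
    by (intro sum.cong refl) (simp add: L2_inner_def)
  finally show ?thesis .
qed

text \<open>Linearity and the action on elementary tensors both hold almost everywhere; as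
  \<open>\<beta>\<close> and \<open>a\<close> take finitely many values, one null set serves for all
  of them.\<close>

lemma tensor_operator_sum:
  assumes T: "\<And>\<beta>. \<beta> \<in> J \<Longrightarrow> tensor_operator lo hi I H tens (B \<beta>) (T \<beta>)"
    and fin: "finite J" "finite K" and w: "\<And>a. a \<in> K \<Longrightarrow> w a \<in> Pi I H"
  shows "AE z in box_measure lo hi I. (\<Sum>\<beta>\<in>J. T \<beta> (\<Sum>a\<in>K. c a *\<^sub>R tens (w a)) z) =
    (\<Sum>\<beta>\<in>J. \<Sum>a\<in>K. c a * tensor_function I (\<lambda>m. B \<beta> m (w a m)) z)"
proof -
  have "AE z in box_measure lo hi I. \<forall>\<beta>\<in>J. T \<beta> (\<Sum>a\<in>K. c a *\<^sub>R tens (w a)) z =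
      (\<Sum>a\<in>K. c a *\<^sub>R T \<beta> (tens (w a)) z)"
    using T fin by (intro AE_finite_allI bounded_linear_to_L2_sum) (auto simp: tensor_operator_def)
  moreover have "AE z in box_measure lo hi I. \<forall>\<beta>\<in>J. \<forall>a\<in>K.
      T \<beta> (tens (w a)) z = tensor_function I (\<lambda>m. B \<beta> m (w a m)) z"
    using T fin w by (intro AE_finite_allI) (auto simp: tensor_operator_def)
  ultimately show ?thesis by eventually_elim simp
qed

section \<open>The Gramian entry and its number of terms\<close>

theorem theorem2p6:
  fixes dx d\<xi> d :: nat
    and lo hi :: "nat \<Rightarrow> real"
    and ev :: "'v::{real_inner,complete_space} \<Rightarrow> (nat \<Rightarrow> real) \<Rightarrow> real"
    and tr :: "'v \<Rightarrow> (nat \<Rightarrow> real) \<Rightarrow> real"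
    and A :: "((nat \<Rightarrow> real) \<Rightarrow> 'v) \<Rightarrow> (nat \<Rightarrow> real) \<Rightarrow> real"
    and H :: "nat \<Rightarrow> 'h::{real_inner,complete_space} set"
    and \<iota> :: "nat \<Rightarrow> 'h \<Rightarrow> real \<Rightarrow> real"
    and tens :: "(nat \<Rightarrow> 'h) \<Rightarrow> 't::{real_inner,complete_space}"
    and emb :: "'t \<Rightarrow> (nat \<Rightarrow> real) \<Rightarrow> 'v"
    and R :: nat
    and B :: "nat \<Rightarrow> nat \<Rightarrow> 'h \<Rightarrow> real \<Rightarrow> real"
    and T :: "nat \<Rightarrow> 't \<Rightarrow> (nat \<Rightarrow> real) \<Rightarrow> real"
    and P k :: "nat \<Rightarrow> nat"
    and \<Phi> :: "nat \<Rightarrow> (nat \<Rightarrow> real) \<Rightarrow> nat \<Rightarrow> 'h"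
    and c :: "(nat \<Rightarrow> nat) \<Rightarrow> real"
    and \<theta> :: "nat \<Rightarrow> nat \<Rightarrow> real"
    and s t i j :: nat
  defines "\<Omega> \<equiv> box_measure lo hi {1..dx}"
    and "\<Xi> \<equiv> box_measure lo hi {dx+1..d}"
    and "\<D> \<equiv> box_measure lo hi {1..d}"
    and "\<G> \<equiv> gramian_entry (box_measure lo hi {1..d}) A emb
           (tensor_network d k c tens \<Phi>) \<theta> s i t j"
    and "summand \<equiv> \<lambda>\<beta> \<gamma> a a'. c a * c a' *
           (\<Prod>m=1..d. L2_inner (interval_measure1 lo hi m)
              (B \<beta> m (factor_derivative \<Phi> \<theta> s i a m))
              (B \<gamma> m (factor_derivative \<Phi> \<theta> t j a' m)))"
    and "N \<equiv> {a \<in> multi_indices d k. c a \<noteq> 0}"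
  assumes dims: "d = dx + d\<xi>" "1 \<le> dx"
    and intervals: "\<And>m. m \<in> {1..d} \<Longrightarrow> lo m < hi m"
    and V_functions: "function_space_on \<Omega> ev"
    and V_trace: "bounded_trace lo hi {1..dx} ev tr"
    and A_bounded: "bounded_linear_L2_L2 \<Xi> \<D> A"
    and H_hilbert: "hilbert_family {1..d} H"
    and H_embedded: "\<And>m. m \<in> {1..d} \<Longrightarrow> embedding_to_L2 (H m) (interval_measure1 lo hi m) (\<iota> m)"
    and H_tensor: "hilbert_tensor_product {1..d} H tens"
    and H_in_U: "embedding_to_L2 UNIV \<Xi> emb" "dense_in_L2 UNIV \<Xi> emb"
    and H_in_U_functions: "\<And>v. v \<in> Pi {1..d} H \<Longrightarrow>
          AE \<xi> in \<Xi>. AE x in \<Omega>. ev (emb (tens v) \<xi>) x =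
            tensor_function {1..d} (\<lambda>m. \<iota> m (v m)) (merge {1..dx} {dx+1..d} (x, \<xi>))"
    and A_factors: "\<And>\<beta> m. \<beta> \<in> {1..R} \<Longrightarrow> m \<in> {1..d} \<Longrightarrow>
          bounded_linear_to_L2 (H m) (interval_measure1 lo hi m) (B \<beta> m)"
    and A_tensor_operators: "\<And>\<beta>. \<beta> \<in> {1..R} \<Longrightarrow> tensor_operator lo hi {1..d} H tens (B \<beta>) (T \<beta>)"
    and A_restriction: "\<And>h. AE z in \<D>. A (emb h) z = (\<Sum>\<beta>=1..R. T \<beta> h z)"
    and \<Phi>_range: "\<And>m x a. m \<in> {1..d} \<Longrightarrow> a \<in> {1..k m} \<Longrightarrow> \<Phi> m x a \<in> H m"
    and \<Phi>_differentiable: "\<And>m x. m \<in> {1..d} \<Longrightarrow> differentiable_map_at (P m) (k m) (\<Phi> m) x"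
    and indices: "s \<in> {1..d}" "t \<in> {1..d}" "i \<in> {1..P s}" "j \<in> {1..P t}"
  shows "\<G> = (\<Sum>\<beta>=1..R. \<Sum>\<gamma>=1..R. \<Sum>a\<in>multi_indices d k. \<Sum>a'\<in>multi_indices d k.
              summand \<beta> \<gamma> a a')
       \<and> \<G> = (\<Sum>(\<beta>, \<gamma>, a, a') \<in> {1..R} \<times> {1..R} \<times> N \<times> N. summand \<beta> \<gamma> a a')
       \<and> card ({1..R} \<times> {1..R} \<times> N \<times> N) \<le> (card N)\<^sup>2 * R\<^sup>2"
proof -
  let ?K = "multi_indices d k"
  let ?p = "factor_derivative \<Phi> \<theta> s i" and ?q = "factor_derivative \<Phi> \<theta> t j"
  note fin = finite_multi_indices[of d k]
  note fd = factor_derivative_in[where \<Phi> = \<Phi> and k = k and P = P, OF H_hilbert H_tensor \<Phi>_range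
      \<Phi>_differentiable]
  have p: "?p a \<in> Pi {1..d} H" and q: "?q a \<in> Pi {1..d} H" if "a \<in> ?K" for a
    using fd[OF _ _ indices(1) indices(1) indices(3) that]
      fd[OF _ _ indices(2) indices(2) indices(4) that]
    by blast+
  \<comment> \<open>\<open>emb h\<close> lies in the Bochner space over \<open>\<Xi>\<close>, which
    \<open>A\<close> maps into the square integrable functions on \<open>\<D>\<close>.\<close>
  have A_meas: "A (emb h) \<in> borel_measurable \<D>" for h
    using H_in_U(1) A_bounded
    by (auto simp: embedding_to_L2_def bounded_linear_to_L2_def bounded_linear_L2_L2_def L2_real)
  \<comment> \<open>On the image of \<open>emb\<close> the operator is a sum of tensor operators, so
    each tangent vector is sent to an explicit sum of product functions. Leaving \<open>w\<close>
    general covers both tangent vectors.\<close>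
  have A_sum: "AE z in \<D>. A (emb (\<Sum>a\<in>?K. c a *\<^sub>R tens (w a))) z =
      (\<Sum>\<beta>=1..R. \<Sum>a\<in>?K. c a * tensor_function {1..d} (\<lambda>m. B \<beta> m (w a m)) z)"
    if "\<And>a. a \<in> ?K \<Longrightarrow> w a \<in> Pi {1..d} H" for w
  proof -
    have "AE z in \<D>. (\<Sum>\<beta>=1..R. T \<beta> (\<Sum>a\<in>?K. c a *\<^sub>R tens (w a)) z) =
        (\<Sum>\<beta>=1..R. \<Sum>a\<in>?K. c a * tensor_function {1..d} (\<lambda>m. B \<beta> m (w a m)) z)"
      unfolding \<D>_def
      by (rule tensor_operator_sum[OF A_tensor_operators finite_atLeastAtMost fin that])
    with A_restriction[of "\<Sum>a\<in>?K. c a *\<^sub>R tens (w a)"] show ?thesis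
      by eventually_elim simp
  qed
  have B_L2: "B \<beta> m (w m) \<in> L2 (interval_measure1 lo hi m)"
    if "\<beta> \<in> {1..R}" "m \<in> {1..d}" "w \<in> Pi {1..d} H" for \<beta> m w
    using A_factors[OF that(1,2)] Pi_mem[OF that(3,2)] by (auto simp: bounded_linear_to_L2_def)
  note bd = block_derivative_tensor_network[where \<Phi> = \<Phi> and k = k and P = P, OF H_hilbert
      H_tensor \<Phi>_range \<Phi>_differentiable]
  have "\<G> = L2_inner \<D> (A (emb (\<Sum>a\<in>?K. c a *\<^sub>R tens (?p a))))
      (A (emb (\<Sum>a\<in>?K. c a *\<^sub>R tens (?q a))))"
    unfolding \<G>_def \<D>_def gramian_entry_def
    using bd[OF _ _ indices(1) indices(1) indices(3)] bd[OF _ _ indices(2) indices(2) indices(4)]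
    by simp
  also have "\<dots> = (\<Sum>\<beta>=1..R. \<Sum>\<gamma>=1..R. \<Sum>a\<in>?K. \<Sum>a'\<in>?K. summand \<beta> \<gamma> a a')"
    unfolding summand_def \<D>_def
    by (intro L2_inner_sum_tensor_function[OF finite_atLeastAtMost finite_atLeastAtMost fin]
        A_sum[unfolded \<D>_def] A_meas[unfolded \<D>_def] B_L2 p q)
  finally have G: "\<G> = (\<Sum>\<beta>=1..R. \<Sum>\<gamma>=1..R. \<Sum>a\<in>?K. \<Sum>a'\<in>?K. summand \<beta> \<gamma> a a')" .
  \<comment> \<open>Every summand carries the factor \<open>c a * c a'\<close>, so only
    multi-indices in the support \<open>N\<close> of \<open>c\<close> contribute; first
    \<open>a\<close> and then \<open>a'\<close> is restricted to \<open>N\<close>.\<close>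
  have N: "N \<subseteq> ?K" "\<And>a. a \<in> ?K - N \<Longrightarrow> c a = 0"
    by (auto simp: N_def)
  have "(\<Sum>a\<in>?K. \<Sum>a'\<in>?K. summand \<beta> \<gamma> a a') = (\<Sum>a\<in>N. \<Sum>a'\<in>N. summand \<beta> \<gamma> a a')"
    for \<beta> \<gamma>
  proof -
    have "(\<Sum>a\<in>?K. \<Sum>a'\<in>?K. summand \<beta> \<gamma> a a') = (\<Sum>a\<in>N. \<Sum>a'\<in>?K. summand \<beta> \<gamma> a a')"
      using N by (intro sum.mono_neutral_right fin) (auto simp: summand_def)
    also have "\<dots> = (\<Sum>a\<in>N. \<Sum>a'\<in>N. summand \<beta> \<gamma> a a')"
      using N by (intro sum.cong refl sum.mono_neutral_right fin) (auto simp: summand_def)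
    finally show ?thesis .
  qed
  with G have "\<G> = (\<Sum>\<beta>=1..R. \<Sum>\<gamma>=1..R. \<Sum>a\<in>N. \<Sum>a'\<in>N. summand \<beta> \<gamma> a a')"
    by simp
  then have "\<G> = (\<Sum>(\<beta>, \<gamma>, a, a') \<in> {1..R} \<times> {1..R} \<times> N \<times> N. summand \<beta> \<gamma> a a')"
    by (simp add: sum.cartesian_product)
  \<comment> \<open>The index set has exactly this many elements; the number of nonzero summands may
    be smaller.\<close>
  moreover have "card ({1..R} \<times> {1..R} \<times> N \<times> N) \<le> (card N)\<^sup>2 * R\<^sup>2"
    by (simp add: card_cartesian_product power2_eq_square)
  ultimately show ?thesis using G by blast
qed

end
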